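(* For every finite antichain $\mathcal F$ (with respect to inclusion) of finite sets of atoms there is a normal logic program $P$ whose family of stable models is exactly $\mathcal F$. Moreover, there exists such a $P$ with at most $\sum_{B\in\mathcal F}|B|$ clauses and total size at most $|\mathcal F|\cdot\sum_{B\in\mathcal F}|B|$.
   Context: A (normal, propositional) logic program is a finite set of clauses $a\leftarrow b_1,\ldots,b_m,\mathbf{not}(c_1),\ldots,\mathbf{not}(c_k)$ ($m,k\ge0$) with atoms $a,b_i,c_j$. For a set of atoms $M$, the Gelfond–Lifschitz reduct $P^M$ is obtained from $P$ by deleting every clause whose body contains $\mathbf{not}(c)$ with $c\in M$ and deleting all negative literals from the remaining clauses; $M$ is a stable model of $P$ if $M$ is the least model of $P^M$. The size of a program is the total number of atom occurrences in it (heads and bodies).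
   Formalization: The bounds on the number of clauses and on the size are claimed only for nonempty families: for the empty family the bound of 0 clauses forces the empty program, which has the empty set as a stable model. *)

theory Defs
  imports Main
begin

text \<open>
  Bodies are lists rather than sets, so that repeated atoms in a body count as separate
  occurrences in the size of a program.
\<close>

datatype 'a clause = Clause (head: 'a) (pos_body: "'a list") (neg_body: "'a list")

type_synonym 'a program = "'a clause set"

definition normal_program :: "'a program \<Rightarrow> bool" where
  "normal_program P \<longleftrightarrow> finite P"

definition satisfies_clause :: "'a set \<Rightarrow> 'a clause \<Rightarrow> bool" where
  "satisfies_clause M C \<longleftrightarrow>
     ((\<forall>b \<in> set (pos_body C). b \<in> M) \<and> (\<forall>c \<in> set (neg_body C). c \<notin> M) \<longrightarrow> head C \<in> M)"

definition is_model :: "'a program \<Rightarrow> 'a set \<Rightarrow> bool" where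
  "is_model P M \<longleftrightarrow> (\<forall>C \<in> P. satisfies_clause M C)"

definition is_least_model :: "'a program \<Rightarrow> 'a set \<Rightarrow> bool" where
  "is_least_model P M \<longleftrightarrow> is_model P M \<and> (\<forall>N. is_model P N \<longrightarrow> M \<subseteq> N)"

definition reduct :: "'a program \<Rightarrow> 'a set \<Rightarrow> 'a program" where
  "reduct P M =
     {Clause (head C) (pos_body C) [] | C. C \<in> P \<and> (\<forall>c \<in> set (neg_body C). c \<notin> M)}"

definition stable_model :: "'a program \<Rightarrow> 'a set \<Rightarrow> bool" where
  "stable_model P M \<longleftrightarrow> is_least_model (reduct P M) M"

definition stable_models :: "'a program \<Rightarrow> 'a set set" where
  "stable_models P = {M. stable_model P M}"

definition clause_size :: "'a clause \<Rightarrow> nat" where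
  "clause_size C = 1 + length (pos_body C) + length (neg_body C)"

definition program_size :: "'a program \<Rightarrow> nat" where
  "program_size P = (\<Sum>C\<in>P. clause_size C)"

definition inclusion_antichain :: "'a set set \<Rightarrow> bool" where
  "inclusion_antichain F \<longleftrightarrow> (\<forall>A \<in> F. \<forall>B \<in> F. A \<subseteq> B \<longrightarrow> A = B)"

text \<open>
  For the empty family the clause bound is 0, which only the empty program meets; by the
  following fact it has a stable model.  The bounds can therefore hold for nonempty families only.
\<close>

lemma stable_models_empty_program: "stable_models {} = {{}}"
  by (auto simp: stable_models_def stable_model_def is_least_model_def is_model_def reduct_def)

end

theory Submission
  imports Defs
begin

text \<open>
  The program consists of the clauses \<open>a \<leftarrow> not(c\<^sub>1), \<dots>, not(c\<^sub>k)\<close> for \<open>a \<in> B \<in> F\<close>, where the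
  \<open>c\<^sub>j\<close> pick one element of \<open>B' - B\<close> for each of the other members \<open>B'\<close> of \<open>F\<close>; they exist because
  \<open>F\<close> is an antichain.  Without positive literals, a stable model \<open>M\<close> is the set of heads of the
  clauses that survive in the reduct, that is, the union of the \<open>B \<in> F\<close> whose \<open>c\<^sub>j\<close> all avoid \<open>M\<close>.
  The \<open>c\<^sub>j\<close> separate the members of \<open>F\<close>, so exactly one \<open>B\<close> survives.
\<close>

text \<open>Without positive literals the reduct consists of facts only. Its models are exactly the
  supersets of the set of their heads, so this set is the least model.\<close>

lemma stable_model_negative_program_iff:
  assumes "\<forall>C \<in> P. pos_body C = []"
  shows "stable_model P M \<longleftrightarrow> M = head ` {C \<in> P. set (neg_body C) \<inter> M = {}}"
proof -
  let ?H = "head ` {C \<in> P. set (neg_body C) \<inter> M = {}}"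
  have model: "is_model (reduct P M) N \<longleftrightarrow> ?H \<subseteq> N" for N
    using assms by (fastforce simp: is_model_def reduct_def satisfies_clause_def)
  show ?thesis
    unfolding stable_model_def is_least_model_def model by blast
qed

text \<open>This serves the empty family, for which the general construction would give the empty
  program. If \<open>a\<close> is in \<open>M\<close>, the clause is deleted and nothing derives
  \<open>a\<close>; otherwise the reduct contains the fact \<open>a\<close>.\<close>

lemma no_stable_models_self_negation: "stable_models {Clause a [] [a]} = {}"
proof -
  have "\<not> stable_model {Clause a [] [a]} M" for M
  proof (cases "a \<in> M")
    case True
    then have "{C \<in> {Clause a [] [a]}. set (neg_body C) \<inter> M = {}} = {}"
      by auto
    with True show ?thesis
      by (subst stable_model_negative_program_iff) auto
  next
    case False
    then have "{C \<in> {Clause a [] [a]}. set (neg_body C) \<inter> M = {}} = {Clause a [] [a]}"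
      by auto
    with False show ?thesis
      by (subst stable_model_negative_program_iff) auto
  qed
  then show ?thesis
    by (simp add: stable_models_def)
qed

text \<open>All clauses contributed by \<open>B\<close> share the one negative body
  \<open>n B\<close>, so they survive or are deleted together.\<close>

definition negative_program :: "'a set set \<Rightarrow> ('a set \<Rightarrow> 'a list) \<Rightarrow> 'a program" where
  "negative_program F n = (\<Union>B\<in>F. (\<lambda>a. Clause a [] (n B)) ` B)"

lemma stable_model_negative_program:
  "stable_model (negative_program F n) M \<longleftrightarrow> M = \<Union>{B \<in> F. set (n B) \<inter> M = {}}"
proof -
  have "head ` {C \<in> negative_program F n. set (neg_body C) \<inter> M = {}} =
      \<Union>{B \<in> F. set (n B) \<inter> M = {}}"
    by (force simp: negative_program_def image_iff)
  then show ?thesis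
    by (subst stable_model_negative_program_iff) (auto simp: negative_program_def)
qed

lemma stable_models_negative_program:
  assumes "F \<noteq> {}"
    and avoids: "\<And>B. B \<in> F \<Longrightarrow> set (n B) \<inter> B = {}"
    and meets: "\<And>B B'. B \<in> F \<Longrightarrow> B' \<in> F \<Longrightarrow> B' \<noteq> B \<Longrightarrow> set (n B) \<inter> B' \<noteq> {}"
  shows "stable_models (negative_program F n) = F"
proof -
  let ?S = "\<lambda>M. {B \<in> F. set (n B) \<inter> M = {}}"
  have "M \<in> F" if M: "M = \<Union>(?S M)" for M
  proof -
    \<comment> \<open>If nothing survived, \<open>M\<close> would be empty and everything would survive.\<close>
    have "?S M \<noteq> {}"
    proof
      assume none: "?S M = {}"
      with M have "M = {}"
        by simp
      with none \<open>F \<noteq> {}\<close> show False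
        by auto
    qed
    then obtain B where B: "B \<in> ?S M"
      by blast
    \<comment> \<open>A second survivor \<open>B'\<close> would be contained in \<open>M\<close>, so
      that \<open>n B\<close>, which meets \<open>B'\<close>, would meet \<open>M\<close> and
      \<open>B\<close> would not survive.\<close>
    have "B' = B" if "B' \<in> ?S M" for B'
    proof (rule ccontr)
      assume "B' \<noteq> B"
      with B that have "set (n B) \<inter> B' \<noteq> {}"
        by (intro meets) auto
      moreover have "B' \<subseteq> M"
        by (subst M) (rule Union_upper[OF that])
      ultimately show False
        using B by blast
    qed
    with B have "?S M = {B}"
      by blast
    with M have "M = B"
      by simp
    with B show ?thesis
      by simp
  qed
  moreover have "M = \<Union>(?S M)" if "M \<in> F" for M
  proof -
    \<comment> \<open>\<open>avoids\<close> lets \<open>M\<close> itself survive, and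
      \<open>meets\<close> eliminates every other member.\<close>
    have "?S M = {M}"
      using that avoids meets by blast
    then show ?thesis
      by simp
  qed
  ultimately show ?thesis
    unfolding stable_models_def stable_model_negative_program by blast
qed

lemma finite_negative_program:
  assumes "finite F" "\<forall>B \<in> F. finite B"
  shows "finite (negative_program F n)"
  using assms by (simp add: negative_program_def)

lemma card_negative_program_le:
  assumes "finite F" "\<forall>B \<in> F. finite B"
  shows "card (negative_program F n) \<le> (\<Sum>B\<in>F. card B)"
proof -
  have "card (negative_program F n) \<le> (\<Sum>B\<in>F. card ((\<lambda>a. Clause a [] (n B)) ` B))"
    unfolding negative_program_def by (rule card_UN_le[OF assms(1)])
  also have "\<dots> \<le> (\<Sum>B\<in>F. card B)"
    using assms(2) by (intro sum_mono card_image_le) auto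
  finally show ?thesis .
qed

lemma program_size_negative_program_le:
  assumes "finite F" "\<forall>B \<in> F. finite B" "\<And>B. B \<in> F \<Longrightarrow> length (n B) < k"
  shows "program_size (negative_program F n) \<le> k * (\<Sum>B\<in>F. card B)"
proof -
  \<comment> \<open>The strict bound on \<open>length (n B)\<close> leaves room for the
    head.\<close>
  have "clause_size C \<le> k" if "C \<in> negative_program F n" for C
    using that assms(3) by (fastforce simp: negative_program_def clause_size_def)
  then have "program_size (negative_program F n) \<le> card (negative_program F n) * k"
    unfolding program_size_def using sum_bounded_above[of "negative_program F n" clause_size k]
    by simp
  also have "\<dots> \<le> (\<Sum>B\<in>F. card B) * k"
    by (rule mult_right_mono[OF card_negative_program_le[OF assms(1,2)]]) simp
  finally show ?thesis
    by (simp add: mult.commute)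
qed

lemma antichain_separating_list:
  assumes "finite F" "inclusion_antichain F" "B \<in> F"
  shows "\<exists>xs. set xs \<inter> B = {} \<and> (\<forall>B' \<in> F. B' \<noteq> B \<longrightarrow> set xs \<inter> B' \<noteq> {}) \<and> length xs < card F"
proof -
  have "\<exists>c. c \<in> B' - B" if "B' \<in> F - {B}" for B'
  proof -
    have "\<not> B' \<subseteq> B"
      using assms(2,3) that by (auto simp: inclusion_antichain_def)
    then show ?thesis
      by blast
  qed
  then have "\<forall>B' \<in> F - {B}. \<exists>c. c \<in> B' - B" ..
  then obtain c where c: "\<forall>B' \<in> F - {B}. c B' \<in> B' - B"
    by (rule bchoice[THEN exE])
  \<comment> \<open>Enumerating the other members without repetition gives one chosen atom for each,
    hence \<open>card F - 1\<close> entries, even if some chosen atoms coincide.\<close>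
  obtain Bs where Bs: "set Bs = F - {B}" "distinct Bs"
    using finite_distinct_list[of "F - {B}"] assms(1) by auto
  have "length Bs = card (F - {B})"
    using distinct_card[OF Bs(2)] Bs(1) by simp
  also have "\<dots> < card F"
    using assms(1,3) by (rule card_Diff1_less)
  finally have "length (map c Bs) < card F"
    by simp
  moreover have "set (map c Bs) \<inter> B = {}" "\<forall>B' \<in> F. B' \<noteq> B \<longrightarrow> set (map c Bs) \<inter> B' \<noteq> {}"
    using c Bs(1) by auto
  ultimately show ?thesis
    by blast
qed

theorem theorem7:
  fixes F :: "'a set set"
  assumes "finite F"
    and "\<forall>B \<in> F. finite B"
    and "inclusion_antichain F"
  shows "(\<exists>P :: 'a program. normal_program P \<and> stable_models P = F) \<and>
    (F \<noteq> {} \<longrightarrow>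
      (\<exists>P :: 'a program. normal_program P \<and> stable_models P = F \<and>
         card P \<le> (\<Sum>B\<in>F. card B) \<and>
         program_size P \<le> card F * (\<Sum>B\<in>F. card B)))"
proof (cases "F = {}")
  case True
  have "normal_program {Clause undefined [] [undefined :: 'a]}"
    by (simp add: normal_program_def)
  moreover have "stable_models {Clause undefined [] [undefined :: 'a]} = F"
    using True by (simp add: no_stable_models_self_negation)
  ultimately show ?thesis
    using True by iprover
next
  case False
  have "\<forall>B \<in> F. \<exists>xs. set xs \<inter> B = {} \<and> (\<forall>B' \<in> F. B' \<noteq> B \<longrightarrow> set xs \<inter> B' \<noteq> {}) \<and>
      length xs < card F"
    using antichain_separating_list[OF assms(1,3)] by blast
  then obtain n where n: "\<forall>B \<in> F. set (n B) \<inter> B = {} \<and>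
      (\<forall>B' \<in> F. B' \<noteq> B \<longrightarrow> set (n B) \<inter> B' \<noteq> {}) \<and> length (n B) < card F"
    by (rule bchoice[THEN exE])
  have "stable_models (negative_program F n) = F"
    using n by (intro stable_models_negative_program[OF False]) blast+
  moreover have "program_size (negative_program F n) \<le> card F * (\<Sum>B\<in>F. card B)"
    using n by (intro program_size_negative_program_le[OF assms(1,2)]) blast
  ultimately show ?thesis
    using finite_negative_program[OF assms(1,2)] card_negative_program_le[OF assms(1,2)]
    unfolding normal_program_def by blast
qed

end
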